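(* Let $\Gamma$ be a finite simple graph with $n$ vertices, and let $m \in \{1,\dots,n\}$. Suppose that $\mu_m(\Gamma) = d_m(\Gamma) - m + 2 = 0$. Then one of the following holds. (1) $m=2$ and $\Gamma$ is $nK_1$. (2) $m=3$ and $\Gamma$ is $2K_2 \cup (n-4)K_1$. (3) $\Gamma$ is $\overline{sK_1 \cup tK_2} \cup (n-m)K_1$ for some $s,t \in \mathbb{Z}$ with $t>0$ and $s \geqslant 0$.
   Context: All graphs are finite and simple. The Laplacian matrix of a graph $\Gamma$ is $L(\Gamma)=D-A$, where $A$ is the adjacency matrix and $D$ is the diagonal matrix of vertex degrees; its eigenvalues are the Laplacian eigenvalues of $\Gamma$. For $\Gamma$ with $n$ vertices, $d_i(\Gamma)$ and $\mu_i(\Gamma)$ denote respectively the $i$-th largest vertex degree and the $i$-th largest Laplacian eigenvalue of $\Gamma$, counted with multiplicity, so $d_1 \geqslant \dots \geqslant d_n$ and $\mu_1 \geqslant \dots \geqslant \mu_n = 0$. $K_r$ is the complete graph on $r$ vertices, $\cup$ denotes disjoint union of graphs, $kG$ is the disjoint union of $k$ copies of $G$, and $\overline{G}$ is the complement of $G$. "$\Gamma$ is $G$" means $\Gamma$ is isomorphic to $G$. *)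

theory Defs
  imports
    "Graph_Theory.Graph_Theory"
    "Jordan_Normal_Form.Char_Poly"
begin

text \<open>
  Finite simple graphs are the \<^locale>\<open>pair_graph\<close>s: finite, symmetric, loop-free sets of
  ordered pairs. An edge is thus represented by two opposite arcs, and the degree of a vertex
  is its out-degree.
\<close>

definition graph_order :: "'a pair_pre_digraph \<Rightarrow> nat" where
  "graph_order G = card (pverts G)"

definition nth_degree :: "nat \<Rightarrow> 'a pair_pre_digraph \<Rightarrow> nat" where
  "nth_degree i G =
     rev (sorted_list_of_multiset
       (image_mset (\<lambda>v. out_degree (with_proj G) v) (mset_set (pverts G)))) ! (i - 1)"

text \<open>
  The matrices are indexed by an arbitrarily chosen enumeration of the vertices; another
  choice conjugates them by a permutation matrix and leaves the spectrum unchanged.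
\<close>

definition vertex_list :: "'a pair_pre_digraph \<Rightarrow> 'a list" where
  "vertex_list G = (SOME vs. distinct vs \<and> set vs = pverts G)"

definition adjacency_mat :: "'a pair_pre_digraph \<Rightarrow> real mat" where
  "adjacency_mat G = mat (graph_order G) (graph_order G)
     (\<lambda>(i, j). if (vertex_list G ! i, vertex_list G ! j) \<in> parcs G then 1 else 0)"

definition degree_mat :: "'a pair_pre_digraph \<Rightarrow> real mat" where
  "degree_mat G = mat (graph_order G) (graph_order G)
     (\<lambda>(i, j). if i = j then real (out_degree (with_proj G) (vertex_list G ! i)) else 0)"

definition laplacian_mat :: "'a pair_pre_digraph \<Rightarrow> real mat" where
  "laplacian_mat G = degree_mat G - adjacency_mat G"

text \<open>
  The Laplacian is real symmetric, so its characteristic polynomial splits over the reals, and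
  algebraic and geometric multiplicities agree. In both ordered lists the index starts at 1.
\<close>

definition nth_laplacian_eigenvalue :: "nat \<Rightarrow> 'a pair_pre_digraph \<Rightarrow> real" where
  "nth_laplacian_eigenvalue i G =
     rev (sorted_list_of_multiset (proots (char_poly (laplacian_mat G)))) ! (i - 1)"

definition complete_graph :: "nat \<Rightarrow> nat pair_pre_digraph" where
  "complete_graph r =
     \<lparr> pverts = {..<r}, parcs = {(u, v). u < r \<and> v < r \<and> u \<noteq> v} \<rparr>"

definition complement_graph :: "'a pair_pre_digraph \<Rightarrow> 'a pair_pre_digraph" where
  "complement_graph G =
     \<lparr> pverts = pverts G,
       parcs = {(u, v). u \<in> pverts G \<and> v \<in> pverts G \<and> u \<noteq> v \<and> (u, v) \<notin> parcs G} \<rparr>"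

definition disjoint_union ::
    "'a pair_pre_digraph \<Rightarrow> 'b pair_pre_digraph \<Rightarrow> ('a + 'b) pair_pre_digraph"
    (infixr \<open>\<uplus>\<close> 65) where
  "G \<uplus> H =
     \<lparr> pverts = pverts G <+> pverts H,
       parcs = {(Inl u, Inl v) | u v. (u, v) \<in> parcs G}
             \<union> {(Inr u, Inr v) | u v. (u, v) \<in> parcs H} \<rparr>"

definition copies :: "nat \<Rightarrow> 'a pair_pre_digraph \<Rightarrow> (nat \<times> 'a) pair_pre_digraph" where
  "copies k G =
     \<lparr> pverts = {..<k} \<times> pverts G,
       parcs = {((i, u), (i, v)) | i u v. i < k \<and> (u, v) \<in> parcs G} \<rparr>"

abbreviation graph_iso :: "'a pair_pre_digraph \<Rightarrow> 'b pair_pre_digraph \<Rightarrow> bool"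
    (infix \<open>\<cong>\<^sub>g\<close> 50) where
  "G \<cong>\<^sub>g H \<equiv> digraph_iso (with_proj G) (with_proj H)"

lemma pair_graph_complete_graph: "pair_graph (complete_graph r)"
proof -
  have "{(u, v). u < r \<and> v < r \<and> u \<noteq> v} \<subseteq> {..<r} \<times> {..<r}" by auto
  then have "finite {(u, v). u < r \<and> v < r \<and> u \<noteq> v}"
    by (rule finite_subset) simp
  then show ?thesis
    by unfold_locales (auto simp: complete_graph_def symmetric_def intro: symI)
qed

lemma complete_digraph_complete_graph: "complete_digraph r (with_proj (complete_graph r))"
  using pair_graph.pair_graphD_graph[OF pair_graph_complete_graph]
  by (auto simp: complete_digraph_def complete_graph_def)

lemma pair_graph_complement_graph:
  assumes "pair_graph G"
  shows "pair_graph (complement_graph G)"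
proof -
  interpret pair_graph G by (fact assms)
  have "parcs (complement_graph G) \<subseteq> pverts G \<times> pverts G"
    by (auto simp: complement_graph_def)
  then have "finite (parcs (complement_graph G))"
    by (rule finite_subset) simp
  then show ?thesis
    using sym_arcs
    by unfold_locales (auto simp: complement_graph_def symmetric_def intro!: symI dest: symD)
qed

lemma pair_graph_disjoint_union:
  assumes "pair_graph G" "pair_graph H"
  shows "pair_graph (G \<uplus> H)"
proof -
  interpret G: pair_graph G by (fact assms)
  interpret H: pair_graph H by (fact assms)
  have "parcs (G \<uplus> H) = map_prod Inl Inl ` parcs G \<union> map_prod Inr Inr ` parcs H"
    by (force simp: disjoint_union_def)
  then have "finite (parcs (G \<uplus> H))" by simp
  then show ?thesis
    using G.sym_arcs H.sym_arcs
    by unfold_locales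
      (auto simp: disjoint_union_def symmetric_def intro!: symI
        dest: symD G.no_loops H.no_loops G.wellformed' H.wellformed')
qed

lemma pair_graph_copies:
  assumes "pair_graph G"
  shows "pair_graph (copies k G)"
proof -
  interpret pair_graph G by (fact assms)
  have "parcs (copies k G) \<subseteq> (\<lambda>(i, (u, v)). ((i, u), (i, v))) ` ({..<k} \<times> parcs G)"
    by (force simp: copies_def)
  then have "finite (parcs (copies k G))"
    by (rule finite_subset) simp
  then show ?thesis
    using sym_arcs
    by unfold_locales
      (auto simp: copies_def symmetric_def intro!: symI dest: symD no_loops wellformed')
qed

end

theory Submission
  imports Defs "Jordan_Normal_Form.Schur_Decomposition"
begin

text \<open>
  The quadratic form of the Laplacian is the sum of \<open>(v u - v w)\<^sup>2\<close> over the edges \<open>uw\<close>, so the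
  Laplacian is positive semidefinite and its kernel consists of the vectors that are constant along
  edges. If \<open>\<mu>\<^sub>m = 0\<close>, then \<open>\<mu>\<^sub>m, \<dots>, \<mu>\<^sub>n\<close> all vanish and the kernel has dimension at least \<open>n - m + 1\<close>.
  For every set \<open>S\<close> of \<open>m\<close> vertices it therefore meets the \<open>m\<close>-dimensional space of vectors supported
  on \<open>S\<close> nontrivially. The support of a nonzero vector in the intersection is a union of
  components. Hence every set of \<open>m\<close> vertices contains a nonempty set that is closed under taking
  neighbours (\<open>closed_subset_of_zero_eigenvalue\<close>), and the rest of the proof is combinatorial.

  The degree condition says that \<open>d\<^sub>m = m - 2\<close>. Let \<open>H\<close> consist of \<open>m\<close> vertices of largest degree. If
  \<open>m = 2\<close>, all vertices but one have degree \<open>0\<close>, so there are no edges. Let \<open>m \<ge> 3\<close> and let \<open>T\<close> be a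
  closed nonempty subset of \<open>H\<close>. A vertex of \<open>T\<close> has at least \<open>m - 2\<close> neighbours, all of them in \<open>T\<close>,
  so \<open>T\<close> has \<open>m\<close> or \<open>m - 1\<close> elements. In either case further \<open>m\<close>-sets, obtained from \<open>H\<close> by exchanging
  one vertex, determine the graph (\<open>high_degree_structure\<close>):

  \<^item> If \<open>T = H\<close>, then all edges lie inside \<open>H\<close>. Each vertex of \<open>H\<close> misses at most one other vertex
    of \<open>H\<close>, and one of them does miss one, so the complement within \<open>H\<close> is a nonempty matching.

  \<^item> If \<open>T\<close> has \<open>m - 1\<close> elements, it is a clique, and the remaining vertex of \<open>H\<close> lies in another
    component. That component is then a single edge, which forces \<open>m = 3\<close>; the clique is also a
    single edge, and there are no further edges.
\<close>

section \<open>Kernels of positive semidefinite matrices\<close>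

text \<open>
  For an eigenvector \<open>v\<close>, the number \<open>v\<^sup>* A v\<close> equals \<open>a |v|\<^sup>2\<close>, and by symmetry of \<open>A\<close> it is its own
  conjugate.
\<close>

lemma eigenvalue_of_real_symmetric_is_real:
  fixes A :: "real mat" and a :: complex
  assumes A: "A \<in> carrier_mat n n" and sym: "transpose_mat A = A"
    and ev: "eigenvalue (map_mat complex_of_real A) a"
  shows "a \<in> \<real>"
proof -
  let ?B = "map_mat complex_of_real A"
  obtain v where v: "v \<in> carrier_vec n" "v \<noteq> 0\<^sub>v n" and Bv: "?B *\<^sub>v v = a \<cdot>\<^sub>v v"
    using ev A unfolding eigenvalue_def eigenvector_def by auto
  have symm: "A $$ (i, j) = A $$ (j, i)" if "i < n" "j < n" for i j
    using arg_cong[OF sym, of "\<lambda>M. M $$ (j, i)"] that A by auto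
  define N where "N = (\<Sum>i<n. (cmod (v $ i))\<^sup>2)"
  define s where "s = (\<Sum>i<n. (\<Sum>j<n. of_real (A $$ (i, j)) * v $ j) * cnj (v $ i))"
  have Bvi: "(\<Sum>j<n. of_real (A $$ (i, j)) * v $ j) = a * v $ i" if "i < n" for i
    using arg_cong[OF Bv, of "\<lambda>w. w $ i"] that A v
    by (simp add: scalar_prod_def lessThan_atLeast0)
  have "s = (\<Sum>i<n. a * (v $ i * cnj (v $ i)))"
    unfolding s_def by (intro sum.cong refl) (simp add: Bvi)
  also have "\<dots> = a * of_real N"
    unfolding N_def of_real_sum sum_distrib_left
    by (intro sum.cong refl) (simp only: complex_norm_square)
  finally have s1: "s = a * of_real N" .
  have "cnj s = (\<Sum>i<n. \<Sum>j<n. of_real (A $$ (i, j)) * cnj (v $ j) * v $ i)"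
    unfolding s_def by (simp add: sum_distrib_right)
  also have "\<dots> = (\<Sum>j<n. \<Sum>i<n. of_real (A $$ (i, j)) * cnj (v $ j) * v $ i)"
    by (rule sum.swap)
  also have "\<dots> = s"
    unfolding s_def sum_distrib_right
    by (intro sum.cong refl) (simp add: symm mult_ac)
  finally have "cnj s = s" .
  then have "cnj a * of_real N = a * of_real N" using s1 by simp
  moreover have "N \<noteq> 0"
  proof
    assume "N = 0"
    then have "\<forall>i<n. v $ i = 0"
      unfolding N_def by (subst (asm) sum_nonneg_eq_0_iff) auto
    then show False using v by (auto intro: eq_vecI)
  qed
  ultimately have "cnj a = a" by simp
  then show ?thesis by (simp add: Reals_cnj_iff)
qed

lemma char_poly_real_symmetric_splits:
  fixes A :: "real mat"
  assumes A: "A \<in> carrier_mat n n" and sym: "transpose_mat A = A"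
  obtains es where "char_poly A = (\<Prod>e\<leftarrow>es. [:- e, 1:])" "length es = n"
proof -
  let ?B = "map_mat complex_of_real A"
  have B: "?B \<in> carrier_mat n n" using A by simp
  obtain as where as: "char_poly ?B = (\<Prod>a\<leftarrow>as. [:- a, 1:])" "length as = n"
    using char_poly_factorized[OF B] by blast
  have "a \<in> \<real>" if "a \<in> set as" for a
  proof (rule eigenvalue_of_real_symmetric_is_real[OF A sym])
    show "eigenvalue ?B a"
      unfolding eigenvalue_root_char_poly[OF B] as(1)
      using that by (auto simp: poly_prod_list prod_list_zero_iff)
  qed
  then have as_Re: "map (\<lambda>a. complex_of_real (Re a)) as = as"
    by (intro map_idI) simp
  interpret lift: map_poly_inj_idom_hom complex_of_real ..
  have hom: "map_poly complex_of_real (\<Prod>e\<leftarrow>es. [:- e, 1:]) = (\<Prod>e\<leftarrow>es. [:- of_real e, 1:])" for es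
    unfolding lift.hom_prod_list by (simp add: o_def)
  have "map_poly complex_of_real (char_poly A) = char_poly ?B"
    by (simp add: of_real_hom.char_poly_hom[OF A])
  also have "\<dots> = map_poly complex_of_real (\<Prod>e\<leftarrow>map Re as. [:- e, 1:])"
    unfolding hom as(1) by (subst as_Re[symmetric]) (simp add: o_def)
  finally have "char_poly A = (\<Prod>e\<leftarrow>map Re as. [:- e, 1:])"
    by (simp only: lift.eq_iff)
  then show thesis using as(2) by (intro that[of "map Re as"]) auto
qed

text \<open>
  Padding the system with zero rows to a square one makes its determinant vanish.
\<close>

lemma underdetermined_system_nontrivial_solution:
  fixes fs :: "'a::field vec list"
  assumes fs: "set fs \<subseteq> carrier_vec n" and len: "length fs < n"
  obtains x where "x \<in> carrier_vec n" "x \<noteq> 0\<^sub>v n" "\<And>f. f \<in> set fs \<Longrightarrow> f \<bullet> x = 0"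
proof -
  define rs where "rs = fs @ replicate (n - length fs) (0\<^sub>v n)"
  have lrs: "length rs = n" using len by (simp add: rs_def)
  have rs: "set rs \<subseteq> carrier_vec n" using fs by (auto simp: rs_def)
  let ?M = "mat_of_rows n rs"
  have M: "?M \<in> carrier_mat n n" using lrs by auto
  have rowM: "row ?M i = rs ! i" if "i < n" for i
    using that lrs rs by (intro mat_of_rows_row) auto
  have "?M = mat\<^sub>r n n (\<lambda>i. if i = n - 1 then 0\<^sub>v n else rs ! i)"
    using len lrs rs by (intro eq_matI) (auto simp: mat_of_rows_def rs_def nth_append)
  then have "det ?M = 0"
    using len lrs rs by (simp only:) (rule det_row_0, auto)
  then obtain x where x: "x \<in> carrier_vec n" "x \<noteq> 0\<^sub>v n" "?M *\<^sub>v x = 0\<^sub>v n"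
    using det_0_iff_vec_prod_zero_field[OF M] by blast
  show thesis
  proof (rule that[OF x(1,2)])
    fix f assume "f \<in> set fs"
    then obtain i where i: "i < length fs" "fs ! i = f" by (auto simp: in_set_conv_nth)
    then have "i < n" using len by simp
    then have "row ?M i \<bullet> x = 0"
      using arg_cong[OF x(3), of "\<lambda>w. w $ i"] index_mult_mat_vec[of i ?M x] lrs by simp
    then show "f \<bullet> x = 0" using rowM[OF \<open>i < n\<close>] i by (simp add: rs_def nth_append)
  qed
qed

lemma mult_mat_vec_nth:
  assumes "M \<in> carrier_mat n n" "x \<in> carrier_vec n" "i < n"
  shows "(M *\<^sub>v x) $ i = (\<Sum>l<n. M $$ (i, l) * x $ l)"
  using assms by (simp add: scalar_prod_def lessThan_atLeast0)

lemma col_zero_nth: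
  assumes "M \<in> carrier_mat n n" "col M j = 0\<^sub>v n" "i < n" "j < n"
  shows "M $$ (i, j) = 0"
  using assms by (metis carrier_matD index_col index_zero_vec(1))

lemma psd_eigenvalues_nonneg:
  fixes A :: "real mat"
  assumes A: "A \<in> carrier_mat n n" and psd: "\<And>v. v \<in> carrier_vec n \<Longrightarrow> v \<bullet> (A *\<^sub>v v) \<ge> 0"
    and ev: "eigenvalue A e"
  shows "e \<ge> 0"
proof -
  obtain v where v: "v \<in> carrier_vec n" "v \<noteq> 0\<^sub>v n" and Av: "A *\<^sub>v v = e \<cdot>\<^sub>v v"
    using ev A unfolding eigenvalue_def eigenvector_def by auto
  have "v \<bullet> v > 0" using conjugate_square_greater_0_vec[OF v(1)] v(2)
    by (simp add: scalar_prod_def conjugate_vec_def)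
  moreover have "e * (v \<bullet> v) \<ge> 0" using psd[OF v(1)] v(1) by (simp add: Av)
  ultimately show ?thesis by (simp add: zero_le_mult_iff)
qed

text \<open>
  The squared norm of \<open>A u\<close> is \<open>u \<bullet> A (A u)\<close>.
\<close>

lemma symmetric_square_zero_imp_zero:
  fixes A :: "real mat"
  assumes A: "A \<in> carrier_mat n n" and sym: "transpose_mat A = A"
    and u: "u \<in> carrier_vec n" and AAu: "A *\<^sub>v (A *\<^sub>v u) = 0\<^sub>v n"
  shows "A *\<^sub>v u = 0\<^sub>v n"
proof -
  have Au: "A *\<^sub>v u \<in> carrier_vec n" using A u by simp
  have "(A *\<^sub>v u) \<bullet> (A *\<^sub>v u) = (transpose_mat A *\<^sub>v (A *\<^sub>v u)) \<bullet> u"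
    using transpose_vec_mult_scalar[OF A u Au] by simp
  also have "\<dots> = 0" using u by (simp add: sym AAu)
  finally show ?thesis
    using conjugate_square_eq_0_vec[OF Au] by (simp add: scalar_prod_def conjugate_vec_def)
qed

text \<open>
  On the span of the first \<open>k\<close> columns of \<open>P\<close> the matrix \<open>A\<close> acts as a strictly upper triangular,
  hence nilpotent, matrix. A symmetric matrix that is nilpotent on an invariant subspace vanishes
  there: inductively, \<open>A\<close> maps the \<open>j\<close>-th column into the span of the earlier ones, so its square
  annihilates that column, and then so does \<open>A\<close> itself. In this way a Schur decomposition of \<open>A\<close>
  yields kernel vectors without a full diagonalization.
\<close>

lemma triangular_leading_zeros_kernel:
  fixes A :: "real mat"
  assumes A: "A \<in> carrier_mat n n" and sym: "transpose_mat A = A"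
    and P: "P \<in> carrier_mat n n" and B: "B \<in> carrier_mat n n"
    and AP: "A * P = P * B" and tri: "upper_triangular B"
    and zero: "\<And>i. i < k \<Longrightarrow> B $$ (i, i) = 0" and k: "k \<le> n" and j: "j < k"
  shows "col (A * P) j = 0\<^sub>v n"
  using j
proof (induction j rule: less_induct)
  case (less j)
  have jn: "j < n" using less.prems k by simp
  have b: "col B j \<in> carrier_vec n" using B by auto
  have colAP: "col (A * P) j = A *\<^sub>v col P j" if "j < n" for j
    using col_mult2[OF A P that] .
  have col': "A *\<^sub>v col P j = P *\<^sub>v col B j"
    using colAP[OF jn] col_mult2[OF P B jn] AP by simp
  have "A *\<^sub>v (P *\<^sub>v col B j) = (A * P) *\<^sub>v col B j"
    using A P b by simp
  also have "\<dots> = 0\<^sub>v n"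
  proof (rule eq_vecI)
    fix i assume "i < dim_vec (0\<^sub>v n :: real vec)"
    then have i: "i < n" by simp
    have "((A * P) *\<^sub>v col B j) $ i = (\<Sum>l<n. (A * P) $$ (i, l) * B $$ (l, j))"
      using i jn B by (subst mult_mat_vec_nth[OF mult_carrier_mat[OF A P] b i]) (auto intro!: sum.cong)
    also have "\<dots> = 0"
    proof (intro sum.neutral ballI)
      fix l assume "l \<in> {..<n}"
      then have l: "l < n" by simp
      show "(A * P) $$ (i, l) * B $$ (l, j) = 0"
      proof (cases "l < j")
        case True
        then have "col (A * P) l = 0\<^sub>v n" using less by simp
        then have "(A * P) $$ (i, l) = 0"
          using i l by (rule col_zero_nth[OF mult_carrier_mat[OF A P]])
        then show ?thesis by simp
      next
        case False
        then have "B $$ (l, j) = 0"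
          using tri zero[OF less.prems] l B by (cases "l = j") (auto simp: upper_triangular_def)
        then show ?thesis by simp
      qed
    qed
    finally show "((A * P) *\<^sub>v col B j) $ i = 0\<^sub>v n $ i" using i by simp
  qed (use A in simp)
  finally have "A *\<^sub>v (A *\<^sub>v col P j) = 0\<^sub>v n" by (simp add: col')
  then have "A *\<^sub>v col P j = 0\<^sub>v n"
    by (rule symmetric_square_zero_imp_zero[OF A sym, rotated]) (use P in auto)
  then show ?case by (simp add: colAP[OF jn])
qed

text \<open>
  Since no eigenvalue is negative, a vanishing \<open>m\<close>-th largest eigenvalue makes the \<open>n - m + 1\<close>
  smallest ones vanish. The kernel then has dimension at least \<open>n - m + 1\<close> and intersects every
  coordinate subspace of dimension \<open>m\<close> nontrivially.
\<close>

lemma psd_kernel_vector_in_coordinate_subspace: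
  fixes A :: "real mat"
  assumes A: "A \<in> carrier_mat n n" and sym: "transpose_mat A = A"
    and psd: "\<And>v. v \<in> carrier_vec n \<Longrightarrow> v \<bullet> (A *\<^sub>v v) \<ge> 0"
    and m: "m \<in> {1..n}"
    and ev: "rev (sorted_list_of_multiset (proots (char_poly A))) ! (m - 1) = 0"
    and S: "S \<subseteq> {..<n}" "card S = m"
  obtains v where "v \<in> carrier_vec n" "v \<noteq> 0\<^sub>v n" "A *\<^sub>v v = 0\<^sub>v n"
    "\<And>i. i < n \<Longrightarrow> i \<notin> S \<Longrightarrow> v $ i = 0"
proof -
  obtain es0 where es0: "char_poly A = (\<Prod>e\<leftarrow>es0. [:- e, 1:])" "length es0 = n"
    using char_poly_real_symmetric_splits[OF A sym] by blast
  \<comment> \<open>In increasing order the zero eigenvalues come first, as the triangular form below requires.\<close>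
  define es where "es = sort es0"
  have len: "length es = n" and sorted: "sorted es" by (simp_all add: es_def es0)
  have es: "char_poly A = (\<Prod>e\<leftarrow>es. [:- e, 1:])"
    unfolding es0(1) prod_mset_prod_list[symmetric] mset_map by (simp add: es_def)
  have "proots (char_poly A) = mset es"
    unfolding es
  proof (induction es)
    case (Cons e es)
    have "(\<Prod>e\<leftarrow>es. [:- e, 1:]) \<noteq> 0" by (auto simp: prod_list_zero_iff)
    then have "proots ([:- e, 1:] * (\<Prod>e\<leftarrow>es. [:- e, 1:])) = mset (e # es)"
      by (subst proots_mult) (auto simp: Cons simp del: mult_pCons_left)
    then show ?case by simp
  qed simp
  then have "rev es ! (m - 1) = 0"
    using ev sorted by (simp add: sorted_sort_id)
  then have mid: "es ! (n - m) = 0" using m len rev_nth[of "m - 1" es] by auto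
  have nonneg: "e \<ge> 0" if "e \<in> set es" for e
  proof (rule psd_eigenvalues_nonneg[OF A psd])
    show "eigenvalue A e"
      unfolding eigenvalue_root_char_poly[OF A] es
      using that by (auto simp: poly_prod_list prod_list_zero_iff)
  qed
  define k where "k = n - m + 1"
  have k: "k \<le> n" using m by (auto simp: k_def)
  have zero: "es ! i = 0" if "i < k" for i
  proof -
    have "es ! i \<le> es ! (n - m)"
      using that sorted len m by (intro sorted_nth_mono) (auto simp: k_def)
    moreover have "es ! i \<ge> 0" using that k len by (intro nonneg) auto
    ultimately show ?thesis using mid by simp
  qed
  obtain B P Q where "schur_decomposition A es = (B, P, Q)"
    by (cases "schur_decomposition A es")
  from schur_decomposition[OF A es this] have wit: "similar_mat_wit A B P Q"
    and tri: "upper_triangular B" and diag: "diag_mat B = es" by auto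
  note w = similar_mat_witD2[OF A wit]
  have "A * P = P * B * (Q * P)" unfolding w(3) using w(4-) by (simp add: assoc_mult_mat[of _ n n _ n _ n])
  then have AP: "A * P = P * B" using w by simp
  have Bzero: "B $$ (i, i) = 0" if "i < k" for i
    using zero[OF that] that k w(5) unfolding diag[symmetric] by (simp add: diag_mat_def)
  have ker: "col (A * P) j = 0\<^sub>v n" if "j < k" for j
    using triangular_leading_zeros_kernel[OF A sym w(6) w(5) AP tri Bzero k that] .
  \<comment> \<open>A kernel vector is sought as \<open>P x\<close>, a combination of the first \<open>k\<close> columns of \<open>P\<close>, that
    vanishes off \<open>S\<close>: these are \<open>(m - 1) + (n - m)\<close> equations in \<open>n\<close> unknowns.\<close>
  define fs where "fs = map (unit_vec n) [k..<n] @ map (row P) (sorted_list_of_set ({..<n} - S))"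
  have "set fs \<subseteq> carrier_vec n" using w(6) by (auto simp: fs_def)
  moreover have "length fs < n"
    using m S by (simp add: fs_def k_def card_Diff_subset finite_subset[OF S(1)])
  ultimately obtain x where x: "x \<in> carrier_vec n" "x \<noteq> 0\<^sub>v n" and fx: "\<And>f. f \<in> set fs \<Longrightarrow> f \<bullet> x = 0"
    by (rule underdetermined_system_nontrivial_solution) blast
  have xk: "x $ j = 0" if "k \<le> j" "j < n" for j
    using fx[of "unit_vec n j"] that x(1) by (simp add: fs_def scalar_prod_left_unit)
  show thesis
  proof (rule that[of "P *\<^sub>v x"])
    show "P *\<^sub>v x \<in> carrier_vec n" using w x by simp
    show "P *\<^sub>v x \<noteq> 0\<^sub>v n"
    proof
      assume "P *\<^sub>v x = 0\<^sub>v n"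
      then have "Q *\<^sub>v (P *\<^sub>v x) = 0\<^sub>v n" using w(7) by (auto intro!: eq_vecI)
      moreover have "Q *\<^sub>v (P *\<^sub>v x) = x"
        unfolding assoc_mult_mat_vec[OF w(7) w(6) x(1), symmetric] w(2) using x(1) by simp
      ultimately show False using x(2) by simp
    qed
    show "(P *\<^sub>v x) $ i = 0" if "i < n" "i \<notin> S" for i
      using fx[of "row P i"] that w by (auto simp: fs_def)
    have "A *\<^sub>v (P *\<^sub>v x) = (A * P) *\<^sub>v x"
      by (rule assoc_mult_mat_vec[OF A w(6) x(1), symmetric])
    also have "\<dots> = 0\<^sub>v n"
    proof (rule eq_vecI)
      fix i assume "i < dim_vec (0\<^sub>v n :: real vec)"
      then have i: "i < n" by simp
      have "((A * P) *\<^sub>v x) $ i = (\<Sum>l<n. (A * P) $$ (i, l) * x $ l)"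
        by (rule mult_mat_vec_nth[OF mult_carrier_mat[OF A w(6)] x(1) i])
      also have "\<dots> = 0"
      proof (intro sum.neutral ballI)
        fix l assume "l \<in> {..<n}"
        then have l: "l < n" by simp
        show "(A * P) $$ (i, l) * x $ l = 0"
        proof (cases "l < k")
          case True
          then have "(A * P) $$ (i, l) = 0"
            using i l by (intro col_zero_nth[OF mult_carrier_mat[OF A w(6)] ker[OF True]])
          then show ?thesis by simp
        qed (use l xk in simp)
      qed
      finally show "((A * P) *\<^sub>v x) $ i = 0\<^sub>v n $ i" using i by simp
    qed (use A in simp)
    finally show "A *\<^sub>v (P *\<^sub>v x) = 0\<^sub>v n" .
  qed
qed

section \<open>The Laplacian and neighbour-closed sets\<close>

lemma vertex_list_enumerates:
  assumes "finite (pverts G)"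
  shows "distinct (vertex_list G)" "set (vertex_list G) = pverts G"
    "length (vertex_list G) = graph_order G"
proof -
  have "distinct (vertex_list G) \<and> set (vertex_list G) = pverts G"
    unfolding vertex_list_def
    by (rule someI_ex) (use finite_distinct_list[OF assms] in blast)
  then show "distinct (vertex_list G)" "set (vertex_list G) = pverts G"
    "length (vertex_list G) = graph_order G"
    by (auto simp: graph_order_def dest: distinct_card)
qed

context pair_graph
begin

lemma arc_sym: "(u, v) \<in> parcs G \<Longrightarrow> (v, u) \<in> parcs G"
  using sym_arcs by (auto dest: symD simp: symmetric_def)

lemma out_degree_eq_card: "out_degree (with_proj G) v = card (parcs G `` {v})"
proof -
  have "out_arcs (with_proj G) v = Pair v ` (parcs G `` {v})"
    by (auto simp: out_arcs_def)
  then show ?thesis by (simp add: out_degree_def card_image inj_on_def)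
qed

lemma laplacian_carrier: "laplacian_mat G \<in> carrier_mat (graph_order G) (graph_order G)"
  unfolding laplacian_mat_def degree_mat_def adjacency_mat_def
  by (intro minus_carrier_mat mat_carrier)

lemma laplacian_symmetric: "transpose_mat (laplacian_mat G) = laplacian_mat G"
  by (intro eq_matI) (auto simp: laplacian_mat_def degree_mat_def adjacency_mat_def dest: arc_sym)

text \<open>
  The sum runs over ordered pairs, so each edge is counted twice; this is the reason for the
  factor \<open>1/2\<close>.
\<close>

lemma laplacian_quadratic_form:
  assumes v: "v \<in> carrier_vec (graph_order G)"
  shows "v \<bullet> (laplacian_mat G *\<^sub>v v) =
    (\<Sum>i<graph_order G. \<Sum>j<graph_order G.
      if (vertex_list G ! i, vertex_list G ! j) \<in> parcs G then (v $ i - v $ j)\<^sup>2 else 0) / 2"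
proof -
  define n where "n = graph_order G"
  define x where "x = vertex_list G"
  define a where "a i j = (if (x ! i, x ! j) \<in> parcs G then 1 else 0 :: real)" for i j
  note x = vertex_list_enumerates[OF pair_finite_verts, folded x_def n_def]
  have asym: "a i j = a j i" for i j using arc_sym by (auto simp: a_def)
  have deg: "real (out_degree (with_proj G) (x ! i)) = (\<Sum>j<n. a i j)" for i
  proof -
    have "\<exists>j<n. u = x ! j" if "(x ! i, u) \<in> parcs G" for u
      using in_arcsD2[OF that] unfolding x(2)[symmetric] x(3)[symmetric] in_set_conv_nth by auto
    then have "parcs G `` {x ! i} = (!) x ` {j. j < n \<and> (x ! i, x ! j) \<in> parcs G}"
      by blast
    moreover have "inj_on ((!) x) {j. j < n \<and> (x ! i, x ! j) \<in> parcs G}"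
      using x by (auto simp: inj_on_def nth_eq_iff_index_eq)
    ultimately have "out_degree (with_proj G) (x ! i) = card {j. j < n \<and> (x ! i, x ! j) \<in> parcs G}"
      by (simp add: out_degree_eq_card card_image)
    then show ?thesis
      by (simp add: a_def sum.If_cases Collect_conj_eq lessThan_def)
  qed
  have L: "laplacian_mat G $$ (i, j) = (if i = j then (\<Sum>l<n. a i l) else 0) - a i j"
    if "i < n" "j < n" for i j
    using that deg[of i] unfolding laplacian_mat_def degree_mat_def adjacency_mat_def
    by (cases "i = j") (simp_all add: n_def[symmetric] x_def[symmetric] a_def)
  have "v \<bullet> (laplacian_mat G *\<^sub>v v) = (\<Sum>i<n. v $ i * (\<Sum>j<n. laplacian_mat G $$ (i, j) * v $ j))"
    using v laplacian_carrier by (simp add: scalar_prod_def n_def lessThan_atLeast0)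
  also have "\<dots> = (\<Sum>i<n. v $ i * ((\<Sum>l<n. a i l) * v $ i - (\<Sum>j<n. a i j * v $ j)))"
  proof (intro sum.cong refl arg_cong2[where f = "(*)"])
    fix i assume "i \<in> {..<n}"
    then have i: "i < n" by simp
    have "(\<Sum>j<n. laplacian_mat G $$ (i, j) * v $ j) =
        (\<Sum>j<n. (if i = j then (\<Sum>l<n. a i l) * v $ i else 0) - a i j * v $ j)"
      using i by (intro sum.cong refl) (auto simp: L algebra_simps)
    then show "(\<Sum>j<n. laplacian_mat G $$ (i, j) * v $ j) = (\<Sum>l<n. a i l) * v $ i - (\<Sum>j<n. a i j * v $ j)"
      using i by (simp add: sum_subtractf)
  qed
  also have "\<dots> = (\<Sum>i<n. \<Sum>j<n. a i j * (v $ i)\<^sup>2) - (\<Sum>i<n. \<Sum>j<n. a i j * (v $ i * v $ j))"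
    by (simp add: right_diff_distrib sum_subtractf sum_distrib_left sum_distrib_right power2_eq_square mult_ac)
  finally have form: "v \<bullet> (laplacian_mat G *\<^sub>v v) =
    (\<Sum>i<n. \<Sum>j<n. a i j * (v $ i)\<^sup>2) - (\<Sum>i<n. \<Sum>j<n. a i j * (v $ i * v $ j))" .
  have swap: "(\<Sum>i<n. \<Sum>j<n. a i j * (v $ j)\<^sup>2) = (\<Sum>i<n. \<Sum>j<n. a i j * (v $ i)\<^sup>2)"
    by (subst sum.swap) (simp add: asym)
  have "(\<Sum>i<n. \<Sum>j<n. if (x ! i, x ! j) \<in> parcs G then (v $ i - v $ j)\<^sup>2 else 0) =
      (\<Sum>i<n. \<Sum>j<n. a i j * (v $ i)\<^sup>2 + a i j * (v $ j)\<^sup>2 - 2 * (a i j * (v $ i * v $ j)))"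
    by (intro sum.cong refl) (auto simp: a_def power2_eq_square algebra_simps)
  also have "\<dots> = (\<Sum>i<n. \<Sum>j<n. a i j * (v $ i)\<^sup>2) + (\<Sum>i<n. \<Sum>j<n. a i j * (v $ j)\<^sup>2)
      - 2 * (\<Sum>i<n. \<Sum>j<n. a i j * (v $ i * v $ j))"
    by (simp add: sum.distrib sum_subtractf sum_distrib_left)
  finally show ?thesis unfolding form swap by (simp add: n_def x_def)
qed

text \<open>
  The neighbour-closed vertex sets are the unions of connected components.
\<close>

definition nbr_closed :: "'a set \<Rightarrow> bool" where
  "nbr_closed T \<longleftrightarrow> parcs G `` T \<subseteq> T"

lemma nbr_closedD: "nbr_closed T \<Longrightarrow> u \<in> T \<Longrightarrow> (u, v) \<in> parcs G \<Longrightarrow> v \<in> T"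
  by (auto simp: nbr_closed_def)

text \<open>
  The closed set is the support of a kernel vector that lives on \<open>S\<close>: such a vector is constant
  along edges.
\<close>

lemma closed_subset_of_zero_eigenvalue:
  assumes m: "m \<in> {1..graph_order G}" and ev: "nth_laplacian_eigenvalue m G = 0"
    and S: "S \<subseteq> pverts G" "card S = m"
  obtains T where "T \<subseteq> S" "T \<noteq> {}" "nbr_closed T"
proof -
  define n where "n = graph_order G"
  define x where "x = vertex_list G"
  note x = vertex_list_enumerates[OF pair_finite_verts, folded x_def n_def]
  define I where "I = {i. i < n \<and> x ! i \<in> S}"
  have "\<exists>j<n. u = x ! j" if "u \<in> S" for u
    using subsetD[OF S(1) that] unfolding x(2)[symmetric] x(3)[symmetric] in_set_conv_nth by auto
  then have "(!) x ` I = S" by (auto simp: I_def)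
  moreover have "inj_on ((!) x) I" using x by (auto simp: inj_on_def I_def nth_eq_iff_index_eq)
  ultimately have cI: "card I = m" using S by (metis card_image)
  have psd: "v \<bullet> (laplacian_mat G *\<^sub>v v) \<ge> 0" if "v \<in> carrier_vec n" for v
    unfolding laplacian_quadratic_form[OF that[unfolded n_def]] by (simp add: sum_nonneg)
  obtain v where v: "v \<in> carrier_vec n" "v \<noteq> 0\<^sub>v n" "laplacian_mat G *\<^sub>v v = 0\<^sub>v n"
    and vI: "\<And>i. i < n \<Longrightarrow> i \<notin> I \<Longrightarrow> v $ i = 0"
    using psd_kernel_vector_in_coordinate_subspace[OF laplacian_carrier laplacian_symmetric
        psd[unfolded n_def] m ev[unfolded nth_laplacian_eigenvalue_def] _ cI, folded n_def]
    by (auto simp: I_def)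
  have "(\<Sum>i<n. \<Sum>j<n. if (x ! i, x ! j) \<in> parcs G then (v $ i - v $ j)\<^sup>2 else 0) = 0"
    using laplacian_quadratic_form[of v] v by (simp add: n_def x_def)
  then have "\<forall>i<n. \<forall>j<n. (if (x ! i, x ! j) \<in> parcs G then (v $ i - v $ j)\<^sup>2 else 0) = 0"
    by (simp add: sum_nonneg_eq_0_iff sum_nonneg)
  then have const: "v $ i = v $ j" if "i < n" "j < n" "(x ! i, x ! j) \<in> parcs G" for i j
    using that by (metis eq_iff_diff_eq_0 zero_eq_power2)
  show thesis
  proof (rule that[of "(!) x ` {i. i < n \<and> v $ i \<noteq> 0}"])
    show "(!) x ` {i. i < n \<and> v $ i \<noteq> 0} \<subseteq> S" using vI by (auto simp: I_def)
    show "(!) x ` {i. i < n \<and> v $ i \<noteq> 0} \<noteq> {}" using v by (auto intro: eq_vecI)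
    have "w \<in> (!) x ` {i. i < n \<and> v $ i \<noteq> 0}"
      if u: "u \<in> (!) x ` {i. i < n \<and> v $ i \<noteq> 0}" and uw: "(u, w) \<in> parcs G" for u w
    proof -
      obtain i where i: "i < n" "v $ i \<noteq> 0" "u = x ! i" using u by auto
      have "w \<in> set x" using in_arcsD2[OF uw] x(2) by simp
      then obtain j where "j < n" "w = x ! j" using x(3) unfolding in_set_conv_nth by auto
      then show ?thesis using const[of i j] i uw by auto
    qed
    then show "nbr_closed ((!) x ` {i. i < n \<and> v $ i \<noteq> 0})"
      unfolding nbr_closed_def by blast
  qed
qed

end

section \<open>Graphs with many components and large degrees\<close>

text \<open>
  The set \<open>H\<close> replaces the ordered degree sequence: its elements are the last \<open>m\<close> entries in a list of
  the vertices sorted by increasing degree.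
\<close>

lemma nth_degree_top_set:
  assumes fin: "finite (pverts G)" and m: "m \<in> {1..graph_order G}"
  obtains H h where "H \<subseteq> pverts G" "card H = m" "h \<in> H"
    "out_degree (with_proj G) h = nth_degree m G"
    "\<And>v. v \<in> H \<Longrightarrow> nth_degree m G \<le> out_degree (with_proj G) v"
    "\<And>v. v \<in> pverts G - H \<Longrightarrow> out_degree (with_proj G) v \<le> nth_degree m G"
proof -
  define d where "d = out_degree (with_proj G)"
  define n where "n = graph_order G"
  obtain xs where xs: "set xs = pverts G" "distinct xs" using finite_distinct_list[OF fin] by blast
  define ys where "ys = sort_key d xs"
  have ys: "set ys = pverts G" "distinct ys" "sorted (map d ys)" using xs by (simp_all add: ys_def)
  have len: "length ys = n" using distinct_card[OF ys(2)] by (simp add: ys n_def graph_order_def)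
  have "image_mset d (mset_set (pverts G)) = mset (map d ys)"
    by (metis mset_map mset_set_set ys(1,2))
  then have "sorted_list_of_multiset (image_mset d (mset_set (pverts G))) = map d ys"
    using ys(3) by (simp only: sorted_list_of_multiset_mset sorted_sort_id)
  then have nth: "nth_degree m G = d (ys ! (n - m))"
    using m len rev_nth[of "m - 1" "map d ys"]
    by (auto simp: nth_degree_def d_def[symmetric] n_def[symmetric])
  have mono: "d (ys ! i) \<le> d (ys ! j)" if "i \<le> j" "j < n" for i j
    using sorted_nth_mono[OF ys(3), of i j] that len by simp
  show thesis
  proof (rule that[of "set (drop (n - m) ys)" "ys ! (n - m)"], unfold nth d_def[symmetric])
    show "set (drop (n - m) ys) \<subseteq> pverts G" using ys(1) set_drop_subset by fastforce
    show "card (set (drop (n - m) ys)) = m"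
      using m ys(2) len by (subst distinct_card) (auto simp: n_def)
    show "ys ! (n - m) \<in> set (drop (n - m) ys)"
      using m len by (auto simp: in_set_conv_nth n_def intro!: exI[of _ 0])
    show "d (ys ! (n - m)) \<le> d v" if "v \<in> set (drop (n - m) ys)" for v
      using that len by (auto simp: in_set_conv_nth intro!: mono)
    show "d v \<le> d (ys ! (n - m))" if "v \<in> pverts G - set (drop (n - m) ys)" for v
    proof -
      have "v \<in> set (take (n - m) ys)"
        using that ys(1) by (metis DiffE UnE append_take_drop_id set_append)
      then show ?thesis using len m by (auto simp: in_set_conv_nth n_def intro!: mono)
    qed
  qed simp_all
qed

context pair_graph
begin

lemma arc_irrefl: "(u, u) \<notin> parcs G"
  using pair_no_loops by fastforce

lemma finite_nbrs: "finite (parcs G `` {v})"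
  by (rule finite_subset[OF _ pair_finite_verts]) (auto dest: in_arcsD2)

lemma nbr_closed_nbrs: "nbr_closed T \<Longrightarrow> v \<in> T \<Longrightarrow> parcs G `` {v} \<subseteq> T - {v}"
  using arc_irrefl by (auto dest: nbr_closedD)

lemma nbr_closed_card_ge:
  assumes "nbr_closed T" "finite T" "v \<in> T"
  shows "Suc (card (parcs G `` {v})) \<le> card T"
proof -
  have "card (parcs G `` {v}) \<le> card (T - {v})"
    using assms by (intro card_mono nbr_closed_nbrs) auto
  moreover have "card T > 0" using assms by (auto simp: card_gt_0_iff)
  ultimately show ?thesis using assms by simp
qed

lemma nbr_closed_full:
  assumes "nbr_closed T" "finite T" "v \<in> T" "card T \<le> Suc (card (parcs G `` {v}))"
  shows "parcs G `` {v} = T - {v}"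
  using assms by (intro card_seteq nbr_closed_nbrs) auto

text \<open>
  If every \<open>m\<close>-set contains a nonempty closed set, then at least \<open>n - m + 1\<close> components exist,
  so the component sizes, each reduced by one, add up to at most \<open>m - 1\<close>. A
  component with a vertex of \<open>H\<close> already contributes at least \<open>m - 2\<close>. Hence either one component takes all of
  \<open>H\<close> and the whole budget, or two components share \<open>2 (m - 2) \<le> m - 1\<close>, that is \<open>m = 3\<close>. The proof
  avoids counting components by applying the hypothesis to suitable sets \<open>S\<close>.
\<close>

lemma high_degree_structure:
  assumes m: "m \<ge> 3" and H: "H \<subseteq> pverts G" "card H = m"
    and deg: "\<And>v. v \<in> H \<Longrightarrow> m - 2 \<le> card (parcs G `` {v})"
    and closed: "\<And>S. S \<subseteq> pverts G \<Longrightarrow> card S = m \<Longrightarrow> \<exists>T\<subseteq>S. T \<noteq> {} \<and> nbr_closed T"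
  shows "parcs G \<subseteq> H \<times> H \<or>
    (m = 3 \<and> (\<exists>a b h z. distinct [a, b, h, z] \<and> {a, b, h, z} \<subseteq> pverts G \<and>
       parcs G = {(a, b), (b, a), (h, z), (z, h)}))"
proof -
  have finH: "finite H" using H(1) pair_finite_verts by (rule finite_subset)
  have big: "m - 1 \<le> card T" if "nbr_closed T" "finite T" "v \<in> T" "v \<in> H" for T v
    using nbr_closed_card_ge[OF that(1-3)] deg[OF that(4)] m by linarith
  have full: "parcs G `` {v} = T - {v}"
    if "nbr_closed T" "finite T" "v \<in> T" "v \<in> H" "card T = m - 1" for T v
    using nbr_closed_full[OF that(1-3)] deg[OF that(4)] that(5) m by linarith
  obtain T where T: "T \<subseteq> H" "T \<noteq> {}" "nbr_closed T" using closed[OF H] by blast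
  have finT: "finite T" using T(1) finH by (rule finite_subset)
  have cT: "m - 1 \<le> card T" using T finT big by blast
  show ?thesis
  proof (cases "T = H")
    case True
    have "x \<in> H \<and> y \<in> H" if xy: "(x, y) \<in> parcs G" for x y
    proof (rule ccontr)
      assume "\<not> (x \<in> H \<and> y \<in> H)"
      then have out: "x \<notin> H" "y \<notin> H" using xy arc_sym T(3) True by (auto dest: nbr_closedD)
      have "x \<noteq> y" using xy arc_irrefl by auto
      obtain a where a: "a \<in> H" using T True by auto
      \<comment> \<open>With \<open>a\<close> exchanged for \<open>x\<close>, a closed subset avoids \<open>x\<close>, whose neighbour \<open>y\<close> is missing.
        It must be the clique \<open>H - {a}\<close>, which leaves \<open>a\<close> isolated.\<close>
      define S where "S = insert x (H - {a})"
      have "card S = m" using out a finH H m by (simp add: S_def)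
      moreover have "S \<subseteq> pverts G" using H in_arcsD1[OF xy] by (auto simp: S_def)
      ultimately obtain T' where T': "T' \<subseteq> S" "T' \<noteq> {}" "nbr_closed T'" using closed by blast
      have "x \<notin> T'"
        using nbr_closedD[OF T'(3) _ xy] T'(1) out \<open>x \<noteq> y\<close> by (auto simp: S_def)
      then have sub: "T' \<subseteq> H - {a}" using T'(1) by (auto simp: S_def)
      have fin': "finite T'" using sub finH finite_subset by blast
      have "m - 1 \<le> card T'" using T'(2,3) sub fin' big by blast
      moreover have "card (H - {a}) = m - 1" using a finH H by simp
      ultimately have eq: "T' = H - {a}" using sub finH by (intro card_seteq) auto
      then have "parcs G `` {v} = T' - {v}" if "v \<in> T'" for v
        using full[OF T'(3) fin' that] that \<open>card (H - {a}) = m - 1\<close> by auto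
      then have "parcs G `` {a} \<inter> T' = {}" using eq by (auto dest: arc_sym)
      moreover have "parcs G `` {a} \<subseteq> H - {a}"
        using nbr_closed_nbrs T(3) True a by blast
      ultimately have "parcs G `` {a} = {}" using eq by blast
      then show False using deg[OF a] m by simp
    qed
    then show ?thesis by auto
  next
    case False
    then have "card T < m" using T(1) finH H psubset_card_mono[of H T] by blast
    then have cT': "card T = m - 1" using cT by simp
    then have "card (H - T) = 1" using T(1) finT H m by (simp add: card_Diff_subset)
    then obtain h where "H - T = {h}" by (auto simp: card_1_singleton_iff)
    then have h: "h \<in> H" "h \<notin> T" by auto
    have clique: "parcs G `` {v} = T - {v}" if "v \<in> T" for v
      using full[OF T(3) finT that _ cT'] that T(1) by blast
    have "parcs G `` {h} \<noteq> {}" using deg[OF h(1)] m by auto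
    then obtain z where hz: "(h, z) \<in> parcs G" by auto
    have zh: "(z, h) \<in> parcs G" using arc_sym[OF hz] .
    have "z \<noteq> h" using hz arc_irrefl by auto
    have "z \<notin> T" using nbr_closedD[OF T(3) _ zh] h by blast
    obtain a where a: "a \<in> T" using T by auto
    \<comment> \<open>Removing \<open>a\<close> excludes the whole clique \<open>T\<close>, so that only \<open>{h, z}\<close> can be closed.\<close>
    define S where "S = insert z (insert h (T - {a}))"
    have "card S = m" using \<open>z \<noteq> h\<close> \<open>z \<notin> T\<close> h a finT cT' m by (simp add: S_def)
    moreover have "S \<subseteq> pverts G" using H T(1) in_arcsD1[OF zh] h by (auto simp: S_def)
    ultimately obtain T' where T': "T' \<subseteq> S" "T' \<noteq> {}" "nbr_closed T'" using closed by blast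
    have aS: "a \<notin> S" using a h \<open>z \<notin> T\<close> by (auto simp: S_def)
    have "u \<notin> T'" if "u \<in> T" for u
    proof
      assume "u \<in> T'"
      then have "u \<noteq> a" using aS T'(1) by blast
      then have "(u, a) \<in> parcs G" using clique[OF that] a by blast
      then show False using nbr_closedD[OF T'(3) \<open>u \<in> T'\<close>] aS T'(1) by blast
    qed
    then have "T' \<subseteq> {h, z}" using T'(1) by (auto simp: S_def)
    moreover have "h \<in> T' \<longleftrightarrow> z \<in> T'" using hz zh nbr_closedD[OF T'(3)] by blast
    ultimately have T'_eq: "T' = {h, z}" using T'(2) by blast
    have "nbr_closed {h, z}" using T'(3) T'_eq by simp
    then have nh: "parcs G `` {h} = {z}" and nz: "parcs G `` {z} = {h}"
      using nbr_closed_nbrs[of "{h, z}"] hz zh \<open>z \<noteq> h\<close> by blast+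
    then have m3: "m = 3" using deg[OF h(1)] m by simp
    then have "card (T - {a}) = 1" using cT' a finT by simp
    then obtain b where "T - {a} = {b}" by (auto simp: card_1_singleton_iff)
    then have b: "T = {a, b}" "a \<noteq> b" using a by auto
    have na: "parcs G `` {a} = {b}" and nb: "parcs G `` {b} = {a}"
      using clique[of a] clique[of b] b by auto
    have dist: "distinct [a, b, h, z]" using b h \<open>z \<notin> T\<close> \<open>z \<noteq> h\<close> by auto
    have V: "{a, b, h, z} \<subseteq> pverts G" using b T(1) H h in_arcsD1[OF zh] by auto
    have only: "x \<in> {a, b, h, z}" if xy: "(x, y) \<in> parcs G" for x y
    proof (rule ccontr)
      assume x: "x \<notin> {a, b, h, z}"
      \<comment> \<open>One endpoint from each of three disjoint edges: no nonempty subset is closed.\<close>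
      have "card {a, h, x} = m" using dist x m3 by auto
      moreover have "{a, h, x} \<subseteq> pverts G" using V in_arcsD1[OF xy] by simp
      ultimately have "\<exists>T\<subseteq>{a, h, x}. T \<noteq> {} \<and> nbr_closed T" by (intro closed)
      then obtain T'' where T'': "T'' \<subseteq> {a, h, x}" "T'' \<noteq> {}" "nbr_closed T''" by blast
      have "a \<notin> T''" using nbr_closedD[OF T''(3), of a b] na T''(1) dist x by auto
      moreover have "h \<notin> T''" using nbr_closedD[OF T''(3), of h z] nh T''(1) dist x by auto
      ultimately have "T'' = {x}" using T''(1,2) by blast
      then show False using nbr_closed_nbrs[OF T''(3), of x] xy by auto
    qed
    have "parcs G = {(a, b), (b, a), (h, z), (z, h)}"
    proof (intro equalityI subrelI)
      fix x y assume xy: "(x, y) \<in> parcs G"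
      then have "y \<in> parcs G `` {x}" by auto
      then show "(x, y) \<in> {(a, b), (b, a), (h, z), (z, h)}"
        using only[OF xy] na nb nh nz by auto
    qed (use na nb nh nz in blast)
    then show ?thesis using m3 dist V by blast
  qed
qed

end

section \<open>Isomorphisms with the standard graphs\<close>

lemma graph_isoI:
  assumes G: "pair_graph G" and bij: "bij_betw f (pverts G) (pverts H)"
    and H: "parcs H \<subseteq> pverts H \<times> pverts H"
    and arcs: "\<And>u v. u \<in> pverts G \<Longrightarrow> v \<in> pverts G \<Longrightarrow> (u, v) \<in> parcs G \<longleftrightarrow> (f u, f v) \<in> parcs H"
  shows "G \<cong>\<^sub>g H"
proof -
  interpret pair_graph G by (fact G)
  define hom where "hom = \<lparr>iso_verts = f, iso_arcs = map_prod f f, iso_head = snd, iso_tail = fst\<rparr>"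
  have inj: "inj_on f (pverts G)" and surj: "f ` pverts G = pverts H"
    using bij by (auto simp: bij_betw_def)
  have wf: "parcs G \<subseteq> pverts G \<times> pverts G" using wellformed' by auto
  have "inj_on (map_prod f f) (parcs G)"
    by (rule inj_on_subset[OF map_prod_inj_on[OF inj inj] wf])
  then have "pre_digraph.digraph_isomorphism (with_proj G) hom"
    using inj wf_digraph_axioms unfolding pre_digraph.digraph_isomorphism_def by (auto simp: hom_def)
  moreover have "map_prod f f ` parcs G = parcs H"
  proof (intro equalityI subsetI)
    fix e assume "e \<in> parcs H"
    moreover have "e \<in> f ` pverts G \<times> f ` pverts G" unfolding surj using H \<open>e \<in> parcs H\<close> by blast
    then obtain u v where "e = map_prod f f (u, v)" "u \<in> pverts G" "v \<in> pverts G" by auto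
    ultimately show "e \<in> map_prod f f ` parcs G" using arcs[of u v] by (simp add: rev_image_eqI)
  qed (use arcs wf in auto)
  then have "with_proj H = app_iso hom (with_proj G)"
    using surj by (simp add: app_iso_def hom_def with_proj_def)
  ultimately show ?thesis unfolding digraph_iso_def by blast
qed

lemma pverts_copies_K: "pverts (copies k (complete_graph r)) = {..<k} \<times> {..<r}"
  by (simp add: copies_def complete_graph_def)

lemma parcs_copies_K1: "parcs (copies k (complete_graph 1)) = {}"
  by (auto simp: copies_def complete_graph_def)

lemma parcs_copies_K2:
  "parcs (copies k (complete_graph 2)) =
    {((i, 0), (i, 1)) | i. i < k} \<union> {((i, 1), (i, 0)) | i. i < k}"
  by (auto simp: copies_def complete_graph_def less_2_cases_iff)

lemma pverts_disjoint_union: "pverts (G \<uplus> H) = pverts G <+> pverts H"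
  by (simp add: disjoint_union_def)

lemma parcs_disjoint_union:
  "(Inl u, Inl u') \<in> parcs (G \<uplus> H) \<longleftrightarrow> (u, u') \<in> parcs G"
  "(Inr v, Inr v') \<in> parcs (G \<uplus> H) \<longleftrightarrow> (v, v') \<in> parcs H"
  "(Inl u, Inr v) \<notin> parcs (G \<uplus> H)"
  "(Inr v, Inl u) \<notin> parcs (G \<uplus> H)"
  by (auto simp: disjoint_union_def)

definition matching_graph :: "nat \<Rightarrow> nat \<Rightarrow> (nat \<times> nat + nat \<times> nat) pair_pre_digraph" where
  "matching_graph s t = copies s (complete_graph 1) \<uplus> copies t (complete_graph 2)"

lemma pverts_matching_graph: "pverts (matching_graph s t) = ({..<s} \<times> {..<1}) <+> ({..<t} \<times> {..<2})"
  by (simp add: matching_graph_def pverts_disjoint_union pverts_copies_K)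

lemma parcs_matching_graph: "(p, q) \<in> parcs (matching_graph s t) \<longleftrightarrow>
  (\<exists>i<t. (p = Inr (i, 0) \<and> q = Inr (i, 1)) \<or> (p = Inr (i, 1) \<and> q = Inr (i, 0)))"
  by (cases p; cases q)
    (auto simp: matching_graph_def parcs_disjoint_union parcs_copies_K1[simplified] parcs_copies_K2[simplified])

lemma bij_betw_singletons:
  assumes "finite X"
  obtains f :: "'a \<Rightarrow> nat \<times> nat" where "bij_betw f X ({..<card X} \<times> {..<1})"
proof -
  obtain e where "bij_betw e X {0..<card X}" using ex_bij_betw_finite_nat[OF assms] by blast
  then have "bij_betw (\<lambda>x. (e x, 0)) X ({..<card X} \<times> {..<1 :: nat})"
    by (auto simp: bij_betw_def inj_on_def image_iff)
  then show thesis by (rule that)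
qed

text \<open>
  Induction on the vertex set removes one matched pair at a time. Single-valuedness of the relation
  \<open>M\<close> expresses that the graph with edge set \<open>M\<close> has maximum degree at most one.
\<close>

lemma matching_structure:
  assumes "finite X" and "M \<subseteq> X \<times> X" and "sym M" and "irrefl M" and "single_valued M"
  shows "\<exists>s t f. bij_betw f X (pverts (matching_graph s t)) \<and> (M \<noteq> {} \<longrightarrow> t > 0) \<and>
    (\<forall>x\<in>X. \<forall>y\<in>X. (x, y) \<in> M \<longleftrightarrow> (f x, f y) \<in> parcs (matching_graph s t))"
  using assms
proof (induction X arbitrary: M rule: finite_psubset_induct)
  case (psubset X)
  show ?case
  proof (cases "M = {}")
    case True
    obtain e :: "_ \<Rightarrow> nat \<times> nat" where "bij_betw e X ({..<card X} \<times> {..<1})"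
      using bij_betw_singletons[OF psubset.hyps] .
    then have "bij_betw (Inl \<circ> e) X (pverts (matching_graph (card X) 0))"
      by (auto simp: pverts_matching_graph bij_betw_def inj_on_def image_comp[symmetric])
    then show ?thesis
      using True parcs_matching_graph by blast
  next
    case False
    then obtain a b where ab: "(a, b) \<in> M" by auto
    have ba: "(b, a) \<in> M" using ab psubset.prems(2) by (rule symD[rotated])
    have "a \<noteq> b" using ab psubset.prems(3) by (auto simp: irrefl_def)
    have inX: "a \<in> X" "b \<in> X" using ab psubset.prems(1) by auto
    have aM: "(a, v) \<in> M \<longleftrightarrow> v = b" and bM: "(b, v) \<in> M \<longleftrightarrow> v = a"
      and Ma: "(v, a) \<in> M \<longleftrightarrow> v = b" and Mb: "(v, b) \<in> M \<longleftrightarrow> v = a" for v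
      using ab ba psubset.prems(2,4) by (auto dest: single_valuedD symD)
    define Y where "Y = X - {a, b}"
    define N where "N = M \<inter> Y \<times> Y"
    have "\<exists>s t f. bij_betw f Y (pverts (matching_graph s t)) \<and> (N \<noteq> {} \<longrightarrow> t > 0) \<and>
      (\<forall>x\<in>Y. \<forall>y\<in>Y. (x, y) \<in> N \<longleftrightarrow> (f x, f y) \<in> parcs (matching_graph s t))"
    proof (rule psubset.IH)
      show "Y \<subset> X" using inX by (auto simp: Y_def)
      show "sym N" using psubset.prems(2) by (auto simp: N_def sym_def)
      show "irrefl N" using psubset.prems(3) by (auto simp: N_def irrefl_def)
      show "single_valued N" using psubset.prems(4) by (auto simp: N_def single_valued_def)
    qed (auto simp: N_def)
    then obtain s t f where f: "bij_betw f Y (pverts (matching_graph s t))"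
      and fN: "\<And>x y. x \<in> Y \<Longrightarrow> y \<in> Y \<Longrightarrow> (x, y) \<in> N \<longleftrightarrow> (f x, f y) \<in> parcs (matching_graph s t)"
      by blast
    define g where "g x = (if x = a then Inr (t, 0) else if x = b then Inr (t, 1) else f x)" for x
    have gY: "g x = f x" if "x \<in> Y" for x using that by (auto simp: g_def Y_def)
    have ga: "g a = Inr (t, 0)" and gb: "g b = Inr (t, 1)" using \<open>a \<noteq> b\<close> by (auto simp: g_def)
    have old: "f x \<in> pverts (matching_graph s t)" if "x \<in> Y" for x
      using f that by (auto simp: bij_betw_def)
    then have fresh: "f x \<noteq> Inr (t, i)" if "x \<in> Y" for x i
      using that by (fastforce simp: pverts_matching_graph)
    have "bij_betw g Y (pverts (matching_graph s t))"
      using f gY by (simp cong: bij_betw_cong)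
    moreover have "bij_betw g {a, b} {Inr (t, 0), Inr (t, 1)}"
      using ga gb \<open>a \<noteq> b\<close> by (auto simp: bij_betw_def)
    ultimately have "bij_betw g (Y \<union> {a, b}) (pverts (matching_graph s t) \<union> {Inr (t, 0), Inr (t, 1)})"
      by (rule bij_betw_combine) (auto simp: pverts_matching_graph)
    moreover have "Y \<union> {a, b} = X" using inX by (auto simp: Y_def)
    moreover have "pverts (matching_graph s t) \<union> {Inr (t, 0), Inr (t, 1)} = pverts (matching_graph s (Suc t))"
      by (auto simp: pverts_matching_graph less_Suc_eq less_2_cases_iff)
    ultimately have g: "bij_betw g X (pverts (matching_graph s (Suc t)))" by simp
    have "(x, y) \<in> M \<longleftrightarrow> (g x, g y) \<in> parcs (matching_graph s (Suc t))" if "x \<in> X" "y \<in> X" for x y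
    proof -
      have cases: "x = a \<or> x = b \<or> x \<in> Y" "y = a \<or> y = b \<or> y \<in> Y" using that by (auto simp: Y_def)
      show ?thesis
      proof (cases "x \<in> Y \<and> y \<in> Y")
        case True
        then have "(x, y) \<in> M \<longleftrightarrow> (f x, f y) \<in> parcs (matching_graph s t)"
          using fN by (simp add: N_def)
        also have "\<dots> \<longleftrightarrow> (f x, f y) \<in> parcs (matching_graph s (Suc t))"
          unfolding parcs_matching_graph using fresh True by (metis less_SucE less_SucI)
        finally show ?thesis using True gY by simp
      next
        case False
        then show ?thesis
          using cases \<open>a \<noteq> b\<close> gY fresh
          by (auto simp: parcs_matching_graph ga gb aM bM Ma Mb Y_def)
      qed
    qed
    then show ?thesis using g by (intro exI[of _ s] exI[of _ "Suc t"] exI[of _ g]) simp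
  qed
qed

lemma edgeless_iso:
  assumes "pair_graph G" "parcs G = {}"
  shows "G \<cong>\<^sub>g copies (graph_order G) (complete_graph 1)"
proof -
  interpret pair_graph G by fact
  obtain f :: "_ \<Rightarrow> nat \<times> nat" where "bij_betw f (pverts G) ({..<graph_order G} \<times> {..<1})"
    using bij_betw_singletons[OF pair_finite_verts] unfolding graph_order_def .
  then show ?thesis
    using assms by (intro graph_isoI[of _ f]) (simp_all add: pverts_copies_K parcs_copies_K1[simplified])
qed

text \<open>
  This reduces an isomorphism with \<open>K \<union> k K\<^sub>1\<close> to a bijection between \<open>K\<close> and a set that contains all edges.
\<close>

lemma isolated_rest_iso:
  assumes G: "pair_graph G" and H: "H \<subseteq> pverts G" "parcs G \<subseteq> H \<times> H"
    and bij: "bij_betw f H (pverts K)" and K: "parcs K \<subseteq> pverts K \<times> pverts K"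
    and arcs: "\<And>u v. u \<in> H \<Longrightarrow> v \<in> H \<Longrightarrow> (u, v) \<in> parcs G \<longleftrightarrow> (f u, f v) \<in> parcs K"
  shows "G \<cong>\<^sub>g K \<uplus> copies (graph_order G - card H) (complete_graph 1)"
proof -
  interpret pair_graph G by fact
  have fin: "finite H" using H(1) pair_finite_verts by (rule finite_subset)
  obtain e :: "_ \<Rightarrow> nat \<times> nat"
    where e: "bij_betw e (pverts G - H) ({..<graph_order G - card H} \<times> {..<1})"
    using bij_betw_singletons[of "pverts G - H"] pair_finite_verts H(1) fin
    by (auto simp: graph_order_def card_Diff_subset)
  define g where "g v = (if v \<in> H then Inl (f v) else Inr (e v))" for v
  have "bij_betw g H (Inl ` pverts K)"
    using bij by (auto simp: bij_betw_def g_def inj_on_def image_iff)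
  moreover have "bij_betw g (pverts G - H) (Inr ` ({..<graph_order G - card H} \<times> {..<1}))"
    using e by (auto simp: bij_betw_def g_def inj_on_def image_iff)
  ultimately have "bij_betw g (H \<union> (pverts G - H)) (Inl ` pverts K \<union> Inr ` ({..<graph_order G - card H} \<times> {..<1}))"
    by (rule bij_betw_combine) auto
  then have "bij_betw g (pverts G) (pverts (K \<uplus> copies (graph_order G - card H) (complete_graph 1)))"
    using H(1) by (simp add: pverts_disjoint_union pverts_copies_K Plus_def Un_absorb1)
  then show ?thesis
  proof (rule graph_isoI[OF G])
    show "parcs (K \<uplus> copies (graph_order G - card H) (complete_graph 1))
        \<subseteq> pverts (K \<uplus> copies (graph_order G - card H) (complete_graph 1))
          \<times> pverts (K \<uplus> copies (graph_order G - card H) (complete_graph 1))"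
      using K by (auto simp: disjoint_union_def parcs_copies_K1[simplified])
    fix u v assume "u \<in> pverts G" "v \<in> pverts G"
    show "(u, v) \<in> parcs G \<longleftrightarrow> (g u, g v) \<in> parcs (K \<uplus> copies (graph_order G - card H) (complete_graph 1))"
      using H(2) arcs[of u v]
      by (auto simp: parcs_disjoint_union parcs_copies_K1[simplified] g_def)
  qed
qed

lemma two_edges_iso:
  assumes G: "pair_graph G" and dist: "distinct [a, b, c, d]" and V: "{a, b, c, d} \<subseteq> pverts G"
    and E: "parcs G = {(a, b), (b, a), (c, d), (d, c)}"
  shows "G \<cong>\<^sub>g copies 2 (complete_graph 2) \<uplus> copies (graph_order G - 4) (complete_graph 1)"
proof -
  define f :: "_ \<Rightarrow> nat \<times> nat"
    where "f v = (if v = a then (0, 0) else if v = b then (0, 1) else if v = c then (1, 0) else (1, 1))" for v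
  have "G \<cong>\<^sub>g copies 2 (complete_graph 2) \<uplus>
      copies (graph_order G - card {a, b, c, d}) (complete_graph 1)"
  proof (rule isolated_rest_iso[OF G V, of f])
    have "{..<2 :: nat} = {0, 1}" by auto
    then show "bij_betw f {a, b, c, d} (pverts (copies 2 (complete_graph 2)))"
      using dist by (auto simp: bij_betw_def inj_on_def f_def pverts_copies_K)
    show "(u, v) \<in> parcs G \<longleftrightarrow> (f u, f v) \<in> parcs (copies 2 (complete_graph 2))"
      if "u \<in> {a, b, c, d}" "v \<in> {a, b, c, d}" for u v
      using that dist by (auto simp: E f_def parcs_copies_K2)
  qed (use E in \<open>auto simp: parcs_copies_K2 pverts_copies_K\<close>)
  moreover have "card {a, b, c, d} = 4" using dist by simp
  ultimately show ?thesis by (simp only:)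
qed

text \<open>
  A vertex of \<open>H\<close> has at least \<open>m - 2\<close> of its \<open>m - 1\<close> possible neighbours in \<open>H\<close>, so non-adjacency
  is a matching on \<open>H\<close>; the vertex \<open>h\<close> of degree exactly \<open>m - 2\<close> makes it nonempty.
\<close>

lemma complement_of_matching_iso:
  assumes G: "pair_graph G" and H: "H \<subseteq> pverts G" "card H = m" "parcs G \<subseteq> H \<times> H"
    and deg: "\<And>v. v \<in> H \<Longrightarrow> m - 2 \<le> card (parcs G `` {v})"
    and h: "h \<in> H" "card (parcs G `` {h}) = m - 2" and m: "m \<ge> 2"
  shows "\<exists>s t. t > 0 \<and> G \<cong>\<^sub>g complement_graph (copies s (complete_graph 1) \<uplus> copies t (complete_graph 2))
    \<uplus> copies (graph_order G - m) (complete_graph 1)"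
proof -
  interpret pair_graph G by fact
  have fin: "finite H" using H(1) pair_finite_verts by (rule finite_subset)
  define M where "M = {(u, v). u \<in> H \<and> v \<in> H \<and> u \<noteq> v \<and> (u, v) \<notin> parcs G}"
  have co: "card (M `` {v}) = m - 1 - card (parcs G `` {v})" if "v \<in> H" for v
  proof -
    have "M `` {v} = (H - {v}) - parcs G `` {v}" using that by (auto simp: M_def)
    moreover have "parcs G `` {v} \<subseteq> H - {v}" using H(3) arc_irrefl by auto
    ultimately show ?thesis using finite_nbrs fin that H(2) by (simp add: card_Diff_subset)
  qed
  have "M `` {h} \<noteq> {}" using co[OF h(1)] h(2) m by auto
  then have ne: "M \<noteq> {}" by auto
  have finM: "finite (M `` {v})" for v by (rule finite_subset[OF _ fin]) (auto simp: M_def)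
  have "single_valued M"
  proof (rule single_valuedI)
    fix x y z assume xy: "(x, y) \<in> M" and xz: "(x, z) \<in> M"
    then have "x \<in> H" by (auto simp: M_def)
    then have "card (M `` {x}) \<le> Suc 0" using co deg[of x] m by fastforce
    then show "y = z" using xy xz finM[of x] by (auto simp: card_le_Suc0_iff_eq)
  qed
  moreover have "sym M" using arc_sym by (auto simp: M_def sym_def)
  moreover have "irrefl M" by (auto simp: M_def irrefl_def)
  moreover have "M \<subseteq> H \<times> H" by (auto simp: M_def)
  ultimately obtain s t f where f: "bij_betw f H (pverts (matching_graph s t))" and "t > 0"
    and fM: "\<And>x y. x \<in> H \<Longrightarrow> y \<in> H \<Longrightarrow> (x, y) \<in> M \<longleftrightarrow> (f x, f y) \<in> parcs (matching_graph s t)"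
    using matching_structure[OF fin, of M] ne by blast
  have "G \<cong>\<^sub>g complement_graph (matching_graph s t) \<uplus> copies (graph_order G - card H) (complete_graph 1)"
  proof (rule isolated_rest_iso[OF G H(1,3)])
    show "bij_betw f H (pverts (complement_graph (matching_graph s t)))"
      using f by (simp add: complement_graph_def)
    show "parcs (complement_graph (matching_graph s t)) \<subseteq>
        pverts (complement_graph (matching_graph s t)) \<times> pverts (complement_graph (matching_graph s t))"
      by (auto simp: complement_graph_def)
    fix u v assume uv: "u \<in> H" "v \<in> H"
    have "f u \<in> pverts (matching_graph s t)" "f v \<in> pverts (matching_graph s t)" "f u = f v \<longleftrightarrow> u = v"
      using f uv by (auto simp: bij_betw_def inj_on_def)
    then show "(u, v) \<in> parcs G \<longleftrightarrow> (f u, f v) \<in> parcs (complement_graph (matching_graph s t))"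
      using fM[OF uv] uv arc_irrefl by (auto simp: complement_graph_def M_def)
  qed
  then show ?thesis using \<open>t > 0\<close> H(2) unfolding matching_graph_def by auto
qed

section \<open>The classification\<close>

theorem theorem2p3:
  fixes \<Gamma> :: "'a pair_pre_digraph" and n m :: nat
  assumes "pair_graph \<Gamma>"
    and "graph_order \<Gamma> = n"
    and "m \<in> {1..n}"
    and "nth_laplacian_eigenvalue m \<Gamma> = real (nth_degree m \<Gamma>) - real m + 2"
    and "real (nth_degree m \<Gamma>) - real m + 2 = 0"
  shows "(m = 2 \<and> \<Gamma> \<cong>\<^sub>g copies n (complete_graph 1))
    \<or> (m = 3 \<and> \<Gamma> \<cong>\<^sub>g copies 2 (complete_graph 2) \<uplus> copies (n - 4) (complete_graph 1))
    \<or> (\<exists>s t :: int. t > 0 \<and> s \<ge> 0 \<and>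
         \<Gamma> \<cong>\<^sub>g complement_graph (copies (nat s) (complete_graph 1) \<uplus> copies (nat t) (complete_graph 2))
             \<uplus> copies (n - m) (complete_graph 1))"
proof -
  interpret pair_graph \<Gamma> by fact
  have d: "nth_degree m \<Gamma> = m - 2" and m2: "m \<ge> 2" using assms(5) by linarith+
  have ev: "nth_laplacian_eigenvalue m \<Gamma> = 0" using assms(4,5) by simp
  have mn: "m \<in> {1..graph_order \<Gamma>}" using assms(2,3) by simp
  obtain H h where H: "H \<subseteq> pverts \<Gamma>" "card H = m" and h: "h \<in> H" "card (parcs \<Gamma> `` {h}) = m - 2"
    and top: "\<And>v. v \<in> H \<Longrightarrow> m - 2 \<le> card (parcs \<Gamma> `` {v})"
    and rest: "\<And>v. v \<in> pverts \<Gamma> - H \<Longrightarrow> card (parcs \<Gamma> `` {v}) \<le> m - 2"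
    using nth_degree_top_set[OF pair_finite_verts mn, unfolded out_degree_eq_card d] by blast
  show ?thesis
  proof (cases "m = 2")
    case True
    \<comment> \<open>Every vertex except the second element of \<open>H\<close> has degree \<open>0\<close>, and an edge needs two ends.\<close>
    have isolated: "parcs \<Gamma> `` {v} = {}" if "v \<in> insert h (pverts \<Gamma> - H)" for v
      using that h(2) rest[of v] True finite_nbrs[of v] by auto
    have "card (H - {h}) = 1" using H(2) h(1) True by simp
    then obtain k where "H - {h} = {k}" by (auto simp: card_1_singleton_iff)
    then have only: "v \<in> pverts \<Gamma> \<Longrightarrow> v \<notin> insert h (pverts \<Gamma> - H) \<Longrightarrow> v = k" for v by blast
    have "parcs \<Gamma> = {}"
    proof (rule ccontr)
      assume "parcs \<Gamma> \<noteq> {}"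
      then obtain u v where uv: "(u, v) \<in> parcs \<Gamma>" by auto
      have "u = k" using only[of u] isolated[of u] uv in_arcsD1[OF uv] by auto
      moreover have "v = k" using only[of v] isolated[of v] arc_sym[OF uv] in_arcsD2[OF uv] by auto
      ultimately show False using uv arc_irrefl by simp
    qed
    then show ?thesis using edgeless_iso[OF assms(1)] True assms(2) by simp
  next
    case False
    then have m3: "m \<ge> 3" using m2 by simp
    have closed: "\<exists>T\<subseteq>S. T \<noteq> {} \<and> nbr_closed T" if "S \<subseteq> pverts \<Gamma>" "card S = m" for S
      by (rule closed_subset_of_zero_eigenvalue[OF mn ev that]) blast
    from high_degree_structure[OF m3 H top closed] show ?thesis
    proof
      assume "parcs \<Gamma> \<subseteq> H \<times> H"
      from complement_of_matching_iso[OF assms(1) H this top h m2] obtain s t where "t > 0"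
        "\<Gamma> \<cong>\<^sub>g complement_graph (copies s (complete_graph 1) \<uplus> copies t (complete_graph 2))
          \<uplus> copies (n - m) (complete_graph 1)"
        unfolding assms(2) by blast
      then have "int t > 0 \<and> int s \<ge> 0 \<and> \<Gamma> \<cong>\<^sub>g complement_graph
          (copies (nat (int s)) (complete_graph 1) \<uplus> copies (nat (int t)) (complete_graph 2))
          \<uplus> copies (n - m) (complete_graph 1)"
        by simp
      then show ?thesis by blast
    next
      assume "m = 3 \<and> (\<exists>a b h z. distinct [a, b, h, z] \<and> {a, b, h, z} \<subseteq> pverts \<Gamma> \<and>
        parcs \<Gamma> = {(a, b), (b, a), (h, z), (z, h)})"
      then show ?thesis using two_edges_iso[OF assms(1)] assms(2) by metis
    qed
  qed
qed

end
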